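(* Let $(X,d)$ be a metric space and $(Y, \varrho)$ be a linear metric space with a translation-invariant metric. Consider $c, \ell \in (0, \infty)$ such that $\ell < c$, an $r \in (0, \infty]$, and set-valued mappings $F, H:X\rightrightarrows Y$. Assume that $F$ has property $(\mathcal{O})$ on $X \times Y$ for $c$ and $\gamma \equiv r$ and that $H$ is Hausdorff-Lipschitz on $X$ with the constant $\ell$. Then the mapping $F+H$ has property $(\mathcal{O})$ on $X \times Y$ for $c - \ell$ and $\gamma \equiv r$.
   Context: A linear metric space is a real vector space with a metric for which addition and scalar multiplication are continuous. $B_X(x,r)$ and $B_X[x,r]$ denote the open and the closed ball (similarly in $Y$), $\overline{C}$ is the closure of $C$; $G(M):=\bigcup_{x\in M}G(x)$; values of set-valued mappings may be empty; $(F+H)(x):=F(x)+H(x)=\{z+w: z\in F(x), w\in H(x)\}$. For $\mu>0$, a mapping $G:X\rightrightarrows Y$ has property $(\mathcal{O})$ on $X\times Y$ for $\mu$ and $\gamma\equiv r$ provided that $B_Y(y,\mu t)\subset\overline{G(B_X(x,t))}$ for each $x\in X$, each $y\in G(x)$, and each $t\in(0,r)$. $H$ is Hausdorff-Lipschitz on $X$ with a constant $\ell>0$ if $H(u)\subset H(u')+B_Y[0,\ell\,d(u,u')]$ for each $u,u'\in X$. *)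

theory Defs
  imports "HOL-Analysis.Analysis" "HOL-Library.Set_Algebras"
begin

text \<open>
  Joint continuity of addition (inherited from \<^class>\<open>topological_monoid_add\<close>) and of scalar
  multiplication. Both are stated with product filters because a class specification cannot
  refer to the product topology on its own type.
\<close>

class linear_metric_space = real_vector + metric_space + topological_monoid_add +
  assumes tendsto_scaleR_Pair:
    "filterlim (\<lambda>p. fst p *\<^sub>R snd p) (nhds (a *\<^sub>R x)) (nhds a \<times>\<^sub>F nhds x)"

lemma continuous_on_add_linear_metric_space:
  "continuous_on UNIV (\<lambda>p :: 'a::linear_metric_space \<times> 'a. fst p + snd p)"
  by (intro continuous_on_add continuous_on_fst continuous_on_snd continuous_on_id)

lemma continuous_on_scaleR_linear_metric_space:
  "continuous_on UNIV (\<lambda>p :: real \<times> 'a::linear_metric_space. fst p *\<^sub>R snd p)"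
  unfolding continuous_on_def
proof
  fix p :: "real \<times> 'a"
  have "filterlim (\<lambda>p. fst p *\<^sub>R snd p) (nhds (fst p *\<^sub>R snd p)) (nhds p)"
    using tendsto_scaleR_Pair[of "fst p" "snd p"] by (simp flip: nhds_prod)
  then show "((\<lambda>p. fst p *\<^sub>R snd p) \<longlongrightarrow> fst p *\<^sub>R snd p) (at p within UNIV)"
    by (rule filterlim_mono) (auto simp: at_within_le_nhds)
qed

instance real_normed_vector \<subseteq> linear_metric_space
proof
  fix a :: real and x :: 'a
  show "filterlim (\<lambda>p. fst p *\<^sub>R snd p) (nhds (a *\<^sub>R x)) (nhds a \<times>\<^sub>F nhds x)"
    by (intro tendsto_scaleR filterlim_fst filterlim_snd)
qed

text \<open>
  Set-valued mappings are functions into sets, with empty values allowed. The radius bound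
  is an \<^typ>\<open>ereal\<close> since it may be infinite.
\<close>

definition property_O ::
    "real \<Rightarrow> ereal \<Rightarrow> ('a::metric_space \<Rightarrow> 'b::metric_space set) \<Rightarrow> bool" where
  "property_O \<mu> r G \<longleftrightarrow>
     (\<forall>x. \<forall>y\<in>G x. \<forall>t::real. 0 < t \<and> ereal t < r \<longrightarrow>
        ball y (\<mu> * t) \<subseteq> closure (\<Union>u\<in>ball x t. G u))"

definition hausdorff_lipschitz ::
    "real \<Rightarrow> ('a::metric_space \<Rightarrow> 'b::linear_metric_space set) \<Rightarrow> bool" where
  "hausdorff_lipschitz l H \<longleftrightarrow> (\<forall>u u'. H u \<subseteq> H u' + cball 0 (l * dist u u'))"

end

theory Submission
  imports Defs
begin

text \<open>
  To reach a point \<open>v\<close> from \<open>z + w\<close> with \<open>z \<in> F x\<close> and \<open>w \<in> H x\<close>, move \<open>z\<close> by means of \<open>F\<close>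
  approximately to \<open>v - w\<close>, at the cost of a step in \<open>X\<close> of length about \<open>e / c\<close>, where \<open>e\<close> is the
  distance of \<open>z + w\<close> from \<open>v\<close>. Correcting \<open>w\<close> to a value of \<open>H\<close> at the new point leaves an
  error of about \<open>(l / c) e\<close>. The steps add up to at most about \<open>e / (c - l)\<close>, and since only
  a point of the closure is sought, finitely many steps suffice and no completeness is needed.
\<close>

lemma property_OD:
  assumes "property_O \<mu> r G" "y \<in> G x" "0 < t" "ereal t < r" "dist y v < \<mu> * t" "0 < e"
  obtains u y' where "dist x u < t" "y' \<in> G u" "dist y' v < e"
proof -
  have "v \<in> closure (\<Union>u\<in>ball x t. G u)"
    using assms unfolding property_O_def by (meson mem_ball subsetD)
  then obtain y' where "y' \<in> (\<Union>u\<in>ball x t. G u)" "dist y' v < e"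
    using \<open>0 < e\<close> by (meson closure_approachable)
  then show thesis
    using that by auto
qed

lemma hausdorff_lipschitzD:
  fixes H :: "'a::metric_space \<Rightarrow> 'b::linear_metric_space set"
  assumes inv: "\<And>x y z :: 'b. dist (x + z) (y + z) = dist x y"
    and "hausdorff_lipschitz l H" "w \<in> H u"
  obtains w' where "w' \<in> H u'" "dist w' w \<le> l * dist u u'"
proof -
  have "w \<in> H u' + cball 0 (l * dist u u')"
    using assms unfolding hausdorff_lipschitz_def by blast
  then obtain w' b where w': "w' \<in> H u'" and b: "dist 0 b \<le> l * dist u u'" and "w = w' + b"
    by (auto elim: set_plus_elim)
  then have "dist w' w = dist 0 b"
    using inv[of 0 w' b] by (simp add: add.commute)
  with w' b show thesis
    using that by simp
qed

text \<open>The slack in both constants is essential. \<open>property_O\<close> asks for a distance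
  strictly below \<open>c * t\<close>, which \<open>c' < c\<close> supplies for
  \<open>t = dist (z + w) v / c'\<close>. It reaches only the closure, so
  \<open>(l' - l) * t\<close> pays for the approximation, on top of the \<open>l * t\<close> lost in
  correcting \<open>w\<close>.\<close>

lemma perturbation_step:
  fixes F H :: "'a::metric_space \<Rightarrow> 'b::linear_metric_space set"
  assumes inv: "\<And>x y z :: 'b. dist (x + z) (y + z) = dist x y"
    and F: "property_O c r F" and H: "hausdorff_lipschitz l H"
    and l: "0 < l" "l < l'" and c: "0 < c'" "c' < c"
    and z: "z \<in> F x" and w: "w \<in> H x"
    and r: "ereal (dist (z + w) v / c') < r"
  obtains x' z' w' where "z' \<in> F x'" "w' \<in> H x'" "dist x x' \<le> dist (z + w) v / c'"
    "dist (z' + w') v \<le> l' * (dist (z + w) v / c')"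
proof (cases "z + w = v")
  \<comment> \<open>Here the radius \<open>t\<close> would be 0, which \<open>property_O\<close>
    excludes; staying at \<open>x\<close> works.\<close>
  case True
  then show thesis
    using that[OF z w] by simp
next
  case False
  define t where "t = dist (z + w) v / c'"
  have t: "0 < t" "dist (z + w) v = c' * t"
    using False c by (auto simp: t_def)
  \<comment> \<open>Translation invariance: aiming \<open>F\<close> at \<open>v - w\<close> is the
    same as aiming the sum at \<open>v\<close> with \<open>w\<close> frozen.\<close>
  have shift: "dist y (v - w) = dist (y + w) v" for y
    using inv[of y w "v - w"] by simp
  have near: "dist z (v - w) < c * t"
    using t c by (simp add: shift)
  have "ereal t < r" "0 < (l' - l) * t"
    using r t(1) l by (auto simp flip: t_def)
  then obtain x' z' where x': "dist x x' < t" and z': "z' \<in> F x'"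
    and e: "dist z' (v - w) < (l' - l) * t"
    using property_OD[OF F z t(1) _ near] by blast
  obtain w' where w': "w' \<in> H x'" and d: "dist w' w \<le> l * dist x x'"
    using hausdorff_lipschitzD[OF inv H w] by blast
  have "dist (z' + w') v \<le> dist (z' + w') (z' + w) + dist (z' + w) v"
    by (rule dist_triangle)
  also have "dist (z' + w') (z' + w) = dist w' w"
    using inv[of w' z' w] by (simp add: add.commute)
  also have "dist w' w \<le> l * t"
    by (rule order.trans[OF d mult_left_mono]) (use x' l in auto)
  also have "dist (z' + w) v \<le> (l' - l) * t"
    using e by (simp add: shift)
  finally have "dist (z' + w') v \<le> l' * t"
    by (simp add: algebra_simps)
  then show thesis
    using that[OF z' w'] x' by (simp add: t_def)
qed

text \<open>The last conjunct is a potential argument: the remaining error divided by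
  \<open>c' - l'\<close> is the budget for all future moves, so distance travelled plus budget never
  exceeds the initial budget.\<close>

lemma perturbation_iterate:
  fixes F H :: "'a::metric_space \<Rightarrow> 'b::linear_metric_space set"
  assumes inv: "\<And>x y z :: 'b. dist (x + z) (y + z) = dist x y"
    and F: "property_O c r F" and H: "hausdorff_lipschitz l H"
    and l: "0 < l" "l < l'" and c: "l' < c'" "c' < c"
    and z: "z \<in> F x" and w: "w \<in> H x"
    and r: "ereal (dist (z + w) v / (c' - l')) < r"
  shows "\<exists>u z' w'. z' \<in> F u \<and> w' \<in> H u \<and> dist (z' + w') v \<le> (l' / c') ^ n * dist (z + w) v
    \<and> dist x u + dist (z' + w') v / (c' - l') \<le> dist (z + w) v / (c' - l')"
proof (induction n)
  case 0
  then show ?case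
    using z w by (intro exI[of _ x] exI[of _ z] exI[of _ w]) simp
next
  case (Suc n)
  define e0 where "e0 = dist (z + w) v"
  from Suc obtain u z1 w1 where 1: "z1 \<in> F u" "w1 \<in> H u"
    and e1: "dist (z1 + w1) v \<le> (l' / c') ^ n * e0"
    and u: "dist x u + dist (z1 + w1) v / (c' - l') \<le> e0 / (c' - l')"
    unfolding e0_def by blast
  define e where "e = dist (z1 + w1) v"
  have pos: "0 < l'" "0 < c'" "0 \<le> e"
    using l c by (auto simp: e_def)
  \<comment> \<open>The next radius is within the remaining budget, hence still below
    \<open>r\<close>.\<close>
  have "e / c' \<le> e / (c' - l')"
    using pos c by (intro divide_left_mono) auto
  also have "\<dots> \<le> e0 / (c' - l')"
    using u zero_le_dist[of x u] unfolding e_def by linarith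
  finally have "ereal (e / c') < r"
    using r by (metis e0_def ereal_less_eq(3) order.strict_trans1)
  then obtain u' z2 w2 where 2: "z2 \<in> F u'" "w2 \<in> H u'" and u': "dist u u' \<le> e / c'"
    and e2: "dist (z2 + w2) v \<le> l' * (e / c')"
    using perturbation_step[OF inv F H l \<open>0 < c'\<close> c(2) 1] unfolding e_def by blast
  have "l' / c' * e \<le> l' / c' * ((l' / c') ^ n * e0)"
    using e1 pos unfolding e_def by (intro mult_left_mono) auto
  then have contr: "dist (z2 + w2) v \<le> (l' / c') ^ Suc n * e0"
    using e2 by simp
  have "dist (z2 + w2) v / (c' - l') \<le> l' * (e / c') / (c' - l')"
    using e2 c by (intro divide_right_mono) auto
  \<comment> \<open>Exact balance, a geometric series of ratio \<open>l' / c'\<close>: cost of one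
    step plus the new budget equals the old budget.\<close>
  moreover have "e / c' + l' * (e / c') / (c' - l') = e / (c' - l')"
    using pos c by (simp add: field_simps)
  moreover have "dist x u' \<le> dist x u + dist u u'"
    by (rule dist_triangle)
  ultimately have "dist x u' + dist (z2 + w2) v / (c' - l') \<le> e0 / (c' - l')"
    using u u' unfolding e_def by linarith
  with 2 contr show ?case
    unfolding e0_def by blast
qed

theorem corollary5p4:
  fixes F H :: "'a::metric_space \<Rightarrow> 'b::linear_metric_space set"
    and c l :: real and r :: ereal
  assumes "\<And>x y z :: 'b. dist (x + z) (y + z) = dist x y"
    and "0 < c" and "0 < l" and "l < c" and "0 < r"
    and "property_O c r F"
    and "hausdorff_lipschitz l H"
  shows "property_O (c - l) r (\<lambda>x. F x + H x)"
  unfolding property_O_def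
proof (intro allI ballI impI subsetI)
  fix x y t v
  assume "y \<in> F x + H x" and t: "0 < t \<and> ereal t < r" and "v \<in> ball y ((c - l) * t)"
  then obtain z w where zw: "z \<in> F x" "w \<in> H x" and less: "dist (z + w) v < (c - l) * t"
    by (auto elim: set_plus_elim)
  define e0 where "e0 = dist (z + w) v"
  \<comment> \<open>The gap between \<open>e0 / t\<close> and \<open>c - l\<close> is 4 \<delta>.
    Shifting both constants by \<delta> uses up half of it, so \<open>c' - l'\<close> stays above
    \<open>e0 / t\<close>.\<close>
  define \<delta> where "\<delta> = (c - l - e0 / t) / 4"
  define l' where "l' = l + \<delta>"
  define c' where "c' = c - \<delta>"
  have "e0 / t < c - l" "0 \<le> e0 / t"
    using less t by (simp_all add: e0_def divide_less_eq)
  moreover have "4 * \<delta> = c - l - e0 / t"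
    by (simp add: \<delta>_def)
  ultimately have l': "l < l'" and lc': "l' < c'" and c': "c' < c" and "e0 / t < c' - l'"
    using l'_def c'_def by linarith+
  then have reach: "e0 / (c' - l') < t"
    using t by (simp add: field_simps)
  then have r: "ereal (dist (z + w) v / (c' - l')) < r"
    using t by (metis e0_def less_ereal.simps(1) order.strict_trans)
  show "v \<in> closure (\<Union>u\<in>ball x t. F u + H u)"
    unfolding closure_approachable
  proof (intro allI impI)
    fix \<epsilon> :: real
    assume "0 < \<epsilon>"
    have "(\<lambda>n. (l' / c') ^ n * e0) \<longlonglongrightarrow> 0"
      using assms(3) l' lc' by (intro tendsto_mult_left_zero LIMSEQ_realpow_zero) auto
    then have "\<forall>\<^sub>F n in sequentially. (l' / c') ^ n * e0 < \<epsilon>"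
      using \<open>0 < \<epsilon>\<close> by (rule order_tendstoD)
    then obtain n where n: "(l' / c') ^ n * e0 < \<epsilon>"
      by (metis eventually_happens' sequentially_bot)
    obtain u z' w' where "z' \<in> F u" "w' \<in> H u" and e: "dist (z' + w') v \<le> (l' / c') ^ n * e0"
      and u: "dist x u + dist (z' + w') v / (c' - l') \<le> e0 / (c' - l')"
      using perturbation_iterate[OF assms(1,6,7,3) l' lc' c' zw r, of n] unfolding e0_def by blast
    \<comment> \<open>Dropping the unspent budget bounds \<open>dist x u\<close> by
      \<open>e0 / (c' - l')\<close>, which is below \<open>t\<close> for every
      \<open>n\<close>.\<close>
    moreover have "0 \<le> dist (z' + w') v / (c' - l')"
      using lc' by simp
    then have "u \<in> ball x t"
      using u reach by simp
    ultimately show "\<exists>y\<in>(\<Union>u\<in>ball x t. F u + H u). dist y v < \<epsilon>"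
      using n by (intro bexI[of _ "z' + w'"]) (auto intro: set_plus_intro)
  qed
qed

end
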